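(* Let Assumption 2 (stated in the context) hold and let $\epsilon,\alpha,\gamma>0$. If the quadratic program (SGF) is feasible everywhere in $\bigcap_{i=0}^r\mathcal{S}_i$, and the closed loop (SGF-CL) has a unique solution for any initial condition in $\bigcap_{i=0}^r\mathcal{S}_i$, then $\bigcap_{i=0}^r\mathcal{S}_i$ is forward invariant for the closed loop (SGF-CL), i.e., every solution starting in this set remains in it for all $t\ge 0$.
   Context: Conventions: for differentiable $g:\mathbb{R}^n\to\mathbb{R}^k$, $\frac{\partial g}{\partial x}\in\mathbb{R}^{k\times n}$ (so partial derivatives of scalar functions are row vectors); for scalar $g$, $\nabla g=(\frac{\partial g}{\partial x})^\top$. Plant: $\dot\xi=f(\xi,\upsilon)$ with $f:\mathbb{R}^n\times\mathbb{R}^m\to\mathbb{R}^n$. Assumption 1 (used to define $w$): for every constant input $\upsilon\equiv u$ the system has a unique globally exponentially stable equilibrium; it is denoted $w(u)$, giving a map $w:\mathbb{R}^m\to\mathbb{R}^n$ with $f(w(u),u)=0$. Data: $\Phi,h:\mathbb{R}^n\to\mathbb{R}$, $b:\mathbb{R}^m\to\mathbb{R}$. Fix $\beta>0$ and set $h_0(x,u)=h(x)$, $h_i(x,u)=\frac{\partial h_{i-1}}{\partial x}(x,u)f(x,u)+\beta h_{i-1}(x,u)$ for $i\ge1$. Let $\mathcal{S}=\{(x,u): h(x)\ge0,\ b(u)\ge0\}$ and $\mathcal{S}_i=\{(x,u): b(u)\ge0,\ h_i(x,u)\ge0\}$ for $i\ge0$, so $\mathcal{S}_0=\mathcal{S}$.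 Assumption 2: (1) there is an integer $r\ge1$ such that $f$ is $(r+1)$-times and $h$ is $(r+2)$-times continuously differentiable; $\mathcal{S}_r\ne\emptyset$; $\frac{\partial h_r}{\partial u}(x,u)\ne0$ for all $(x,u)\in\mathcal{S}_r$ with $h_r(x,u)=0$; and $\frac{\partial h_i}{\partial u}(x,u)=0$ for all $(x,u)\in\mathcal{S}_r$ and all $i<r$. (2) $b$ is twice continuously differentiable, and $b(u)=0$ implies $\nabla b(u)\neq0$ for all $(x,u)\in\mathcal{S}$. (3) $\Phi$ and $w$ are twice continuously differentiable. This fixes $r$. Quadratic program (SGF), with parameters $\epsilon,\alpha,\gamma>0$: for given $(x,u)$, minimize over $q\in\mathbb{R}^m$ the function $\frac12\|q+\epsilon\frac{\partial w}{\partial u}(u)^\top\nabla\Phi(x)\|^2$ subject to $\nabla b(u)^\top q+\alpha b(u)\ge0$ and $\frac{\partial h_r}{\partial x}(x,u)f(x,u)+\frac{\partial h_r}{\partial u}(x,u)q+\gamma h_r(x,u)\ge0$. When feasible, its unique minimizer is $g_{\epsilon,\alpha,\gamma}(x,u)$. Closed loop (SGF-CL): $\dot\xi=f(\xi,\upsilon)$, $\dot\upsilon=g_{\epsilon,\alpha,\gamma}(\xi,\upsilon)$. *)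

theory Defs
  imports "HOL-Analysis.Analysis"
begin

(* On a finite-dimensional domain, f is k+1 times continuously differentiable iff it is
   differentiable and all its directional derivatives are k times continuously differentiable. *)
primrec Ck :: "nat \<Rightarrow> ('a::euclidean_space \<Rightarrow> 'b::real_normed_vector) \<Rightarrow> bool" where
  "Ck 0 f \<longleftrightarrow> continuous_on UNIV f"
| "Ck (Suc k) f \<longleftrightarrow>
     (\<forall>x. f differentiable (at x)) \<and> (\<forall>v. Ck k (\<lambda>x. frechet_derivative f (at x) v))"

(* Row vectors of partial derivatives of scalar functions are represented by the gradient:
   the product of the row vector with a column vector v is the inner product with v. *)
definition gradient :: "('a::real_inner \<Rightarrow> real) \<Rightarrow> 'a \<Rightarrow> 'a" where
  "gradient g x = (THE D. GDERIV g x :> D)"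

definition time_interval :: "ereal \<Rightarrow> real set" where
  "time_interval T = {t. 0 \<le> t \<and> ereal t < T}"

(* Classical solutions on [0,T), with T possibly infinite, of z' = F z for a vector field that is
   only defined on D; the values of F outside D are irrelevant. *)
definition ode_solution :: "'a::real_normed_vector set \<Rightarrow> ('a \<Rightarrow> 'a) \<Rightarrow> ereal \<Rightarrow> (real \<Rightarrow> 'a) \<Rightarrow> bool" where
  "ode_solution D F T z \<longleftrightarrow>
     (\<forall>t\<in>time_interval T. z t \<in> D \<and>
        (z has_vector_derivative F (z t)) (at t within time_interval T))"

(* Solutions may be defined on different time intervals, so uniqueness is agreement on the
   common interval; neither existence nor uniqueness requires solutions to be global. *)
definition has_unique_solution :: "'a::real_normed_vector set \<Rightarrow> ('a \<Rightarrow> 'a) \<Rightarrow> 'a \<Rightarrow> bool" where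
  "has_unique_solution D F z0 \<longleftrightarrow>
     (\<exists>T z. T > 0 \<and> ode_solution D F T z \<and> z 0 = z0) \<and>
     (\<forall>T1 z1 T2 z2.
        ode_solution D F T1 z1 \<and> z1 0 = z0 \<and> ode_solution D F T2 z2 \<and> z2 0 = z0 \<longrightarrow>
        (\<forall>t\<in>time_interval T1 \<inter> time_interval T2. z1 t = z2 t))"

definition forward_invariant :: "'a::real_normed_vector set \<Rightarrow> ('a \<Rightarrow> 'a) \<Rightarrow> 'a set \<Rightarrow> bool" where
  "forward_invariant D F C \<longleftrightarrow>
     (\<forall>T z. ode_solution D F T z \<and> z 0 \<in> C \<longrightarrow> (\<forall>t\<in>time_interval T. z t \<in> C))"

definition ges_equilibrium :: "('a::real_normed_vector \<Rightarrow> 'a) \<Rightarrow> 'a \<Rightarrow> bool" where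
  "ges_equilibrium F xe \<longleftrightarrow>
     F xe = 0 \<and>
     (\<forall>x0. \<exists>x. ode_solution UNIV F \<infinity> x \<and> x 0 = x0) \<and>
     (\<exists>K>0. \<exists>c>0. \<forall>T x. ode_solution UNIV F T x \<longrightarrow>
        (\<forall>t\<in>time_interval T. norm (x t - xe) \<le> K * exp (- c * t) * norm (x 0 - xe)))"

(* The map w. *)
definition steady_state :: "(real^'n \<Rightarrow> real^'m \<Rightarrow> real^'n) \<Rightarrow> real^'m \<Rightarrow> real^'n" where
  "steady_state f u = (THE xe. ges_equilibrium (\<lambda>x. f x u) xe)"

primrec hseq :: "(real^'n \<Rightarrow> real^'m \<Rightarrow> real^'n) \<Rightarrow> (real^'n \<Rightarrow> real) \<Rightarrow> real
    \<Rightarrow> nat \<Rightarrow> real^'n \<Rightarrow> real^'m \<Rightarrow> real" where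
  "hseq f h \<beta> 0 = (\<lambda>x u. h x)"
| "hseq f h \<beta> (Suc i) =
     (\<lambda>x u. gradient (\<lambda>y. hseq f h \<beta> i y u) x \<bullet> f x u + \<beta> * hseq f h \<beta> i x u)"

definition constraint_set :: "(real^'n \<Rightarrow> real) \<Rightarrow> (real^'m \<Rightarrow> real) \<Rightarrow> ((real^'n) \<times> (real^'m)) set" where
  "constraint_set h b = {(x, u). h x \<ge> 0 \<and> b u \<ge> 0}"

definition Sset :: "(real^'n \<Rightarrow> real^'m \<Rightarrow> real^'n) \<Rightarrow> (real^'n \<Rightarrow> real) \<Rightarrow> (real^'m \<Rightarrow> real) \<Rightarrow> real
    \<Rightarrow> nat \<Rightarrow> ((real^'n) \<times> (real^'m)) set" where
  "Sset f h b \<beta> i = {(x, u). b u \<ge> 0 \<and> hseq f h \<beta> i x u \<ge> 0}"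

definition sgf_feasible :: "(real^'n \<Rightarrow> real^'m \<Rightarrow> real^'n) \<Rightarrow> (real^'n \<Rightarrow> real) \<Rightarrow> (real^'m \<Rightarrow> real)
    \<Rightarrow> real \<Rightarrow> nat \<Rightarrow> real \<Rightarrow> real \<Rightarrow> real^'n \<Rightarrow> real^'m \<Rightarrow> (real^'m) set" where
  "sgf_feasible f h b \<beta> r \<alpha> \<gamma> x u =
     {q. gradient b u \<bullet> q + \<alpha> * b u \<ge> 0 \<and>
         gradient (\<lambda>y. hseq f h \<beta> r y u) x \<bullet> f x u
           + gradient (\<lambda>v. hseq f h \<beta> r x v) u \<bullet> q
           + \<gamma> * hseq f h \<beta> r x u \<ge> 0}"

definition sgf_cost :: "(real^'n \<Rightarrow> real^'m \<Rightarrow> real^'n) \<Rightarrow> (real^'n \<Rightarrow> real) \<Rightarrow> real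
    \<Rightarrow> real^'n \<Rightarrow> real^'m \<Rightarrow> real^'m \<Rightarrow> real" where
  "sgf_cost f \<Phi> \<epsilon> x u q =
     1/2 * (norm (q + \<epsilon> *\<^sub>R
       (transpose (matrix (frechet_derivative (steady_state f) (at u))) *v gradient \<Phi> x)))\<^sup>2"

definition sgf :: "(real^'n \<Rightarrow> real^'m \<Rightarrow> real^'n) \<Rightarrow> (real^'n \<Rightarrow> real) \<Rightarrow> (real^'n \<Rightarrow> real)
    \<Rightarrow> (real^'m \<Rightarrow> real) \<Rightarrow> real \<Rightarrow> nat \<Rightarrow> real \<Rightarrow> real \<Rightarrow> real \<Rightarrow> real^'n \<Rightarrow> real^'m \<Rightarrow> real^'m" where
  "sgf f \<Phi> h b \<beta> r \<epsilon> \<alpha> \<gamma> x u =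
     (THE q. is_arg_min (sgf_cost f \<Phi> \<epsilon> x u) (\<lambda>q. q \<in> sgf_feasible f h b \<beta> r \<alpha> \<gamma> x u) q)"

(* The closed-loop vector field is defined exactly where the quadratic program is feasible. *)
definition sgf_domain :: "(real^'n \<Rightarrow> real^'m \<Rightarrow> real^'n) \<Rightarrow> (real^'n \<Rightarrow> real) \<Rightarrow> (real^'m \<Rightarrow> real)
    \<Rightarrow> real \<Rightarrow> nat \<Rightarrow> real \<Rightarrow> real \<Rightarrow> ((real^'n) \<times> (real^'m)) set" where
  "sgf_domain f h b \<beta> r \<alpha> \<gamma> = {(x, u). sgf_feasible f h b \<beta> r \<alpha> \<gamma> x u \<noteq> {}}"

definition sgf_closed_loop :: "(real^'n \<Rightarrow> real^'m \<Rightarrow> real^'n) \<Rightarrow> (real^'n \<Rightarrow> real) \<Rightarrow> (real^'n \<Rightarrow> real)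
    \<Rightarrow> (real^'m \<Rightarrow> real) \<Rightarrow> real \<Rightarrow> nat \<Rightarrow> real \<Rightarrow> real \<Rightarrow> real
    \<Rightarrow> (real^'n) \<times> (real^'m) \<Rightarrow> (real^'n) \<times> (real^'m)" where
  "sgf_closed_loop f \<Phi> h b \<beta> r \<epsilon> \<alpha> \<gamma> = (\<lambda>(x, u). (f x u, sgf f \<Phi> h b \<beta> r \<epsilon> \<alpha> \<gamma> x u))"

end

theory Submission
  imports Defs
begin

text \<open>
  Along a closed-loop solution \<open>(x, u)\<close> the quadratic program is feasible at every time, so its minimizer
  exists and satisfies both constraints. By the chain rule these constraints say exactly that \<open>b u\<close> and
  \<open>h\<^sub>r (x, u)\<close> satisfy differential inequalities \<open>g' \<ge> - c * g\<close> with \<open>c = \<alpha>\<close> and \<open>c = \<gamma>\<close>; hence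
  \<open>exp (c * t) * g t\<close> is nondecreasing and both functions stay nonnegative
  (\<open>nonneg_of_derivative_ge\<close>). In particular the solution never leaves \<open>S\<^sub>r\<close>, where
  \<open>h\<^sub>i\<close> with \<open>i < r\<close> does not depend on \<open>u\<close> to first order. There the definition of \<open>h\<^sub>i\<^sub>+\<^sub>1\<close> reads
  \<open>(h\<^sub>i)' = h\<^sub>i\<^sub>+\<^sub>1 - \<beta> * h\<^sub>i\<close> along the solution, so nonnegativity passes
  from \<open>h\<^sub>i\<^sub>+\<^sub>1\<close> to \<open>h\<^sub>i\<close>, and descending from \<open>r\<close> to \<open>0\<close> gives the claim.

  The chain rule requires each \<open>h\<^sub>i\<close> to be jointly differentiable in state and input. Each step of the
  recursion costs one derivative of \<open>h\<^sub>i\<close>, and \<open>f\<close> is smooth enough not to cost more, so \<open>h\<^sub>i\<close> is of class \<open>r + 2 - i\<close> (\<open>Ck_hseq\<close>).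
\<close>

section \<open>Calculus of continuously differentiable functions\<close>

lemma Ck_Suc_iff:
  assumes "\<And>x. (f has_derivative f' x) (at x)"
  shows "Ck (Suc k) f \<longleftrightarrow> (\<forall>v. Ck k (\<lambda>x. f' x v))"
proof -
  have "frechet_derivative f (at x) = f' x" for x
    using frechet_derivative_at[OF assms] by simp
  moreover have "\<forall>x. f differentiable (at x)"
    using assms differentiable_def by blast
  ultimately show ?thesis by simp
qed

lemma Ck_Suc_has_derivative:
  assumes "Ck (Suc k) f"
  shows "(f has_derivative frechet_derivative f (at x)) (at x)"
  using assms by (simp add: frechet_derivative_works[symmetric])

lemma Ck_Suc_imp_Ck: "Ck (Suc k) f \<Longrightarrow> Ck k f"
proof (induction k arbitrary: f)
  case 0
  then show ?case
    by (auto intro!: differentiable_imp_continuous_on simp: differentiable_on_def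
        intro: differentiable_at_withinI)
next
  case (Suc k)
  then show ?case by (metis Ck.simps(2))
qed

lemma Ck_mono: "Ck k f \<Longrightarrow> j \<le> k \<Longrightarrow> Ck j f"
  by (induction k) (auto simp: le_Suc_eq dest: Ck_Suc_imp_Ck simp del: Ck.simps)

lemma Ck_add: "Ck k f \<Longrightarrow> Ck k g \<Longrightarrow> Ck k (\<lambda>x. f x + g x)"
proof (induction k arbitrary: f g)
  case 0
  then show ?case by (simp add: continuous_on_add)
next
  case (Suc k)
  note der = Suc.prems[THEN Ck_Suc_has_derivative]
  show ?case
    unfolding Ck_Suc_iff[OF has_derivative_add[OF der]] using Suc by simp
qed

lemma Ck_const: "Ck k (\<lambda>x. c)"
proof (induction k arbitrary: c)
  case (Suc k)
  then show ?case by (simp add: Ck_Suc_iff[OF has_derivative_const] del: Ck.simps)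
qed simp

lemma Ck_sum: "finite A \<Longrightarrow> (\<And>i. i \<in> A \<Longrightarrow> Ck k (f i)) \<Longrightarrow> Ck k (\<lambda>x. \<Sum>i\<in>A. f i x)"
  by (induction A rule: finite_induct) (auto intro: Ck_const Ck_add)

lemma Ck_bounded_linear:
  assumes "bounded_linear L"
  shows "Ck k f \<Longrightarrow> Ck k (\<lambda>x. L (f x))"
proof (induction k arbitrary: f)
  case 0
  then show ?case using bounded_linear.continuous_on[OF assms] by simp
next
  case (Suc k)
  show ?case
    unfolding Ck_Suc_iff[OF bounded_linear.has_derivative[OF assms Ck_Suc_has_derivative[OF Suc.prems]]]
    using Suc by simp
qed

lemma Ck_mult:
  fixes f g :: "'a::euclidean_space \<Rightarrow> real"
  shows "Ck k f \<Longrightarrow> Ck k g \<Longrightarrow> Ck k (\<lambda>x. f x * g x)"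
proof (induction k arbitrary: f g)
  case 0
  then show ?case by (simp add: continuous_on_mult)
next
  case (Suc k)
  note der = Suc.prems[THEN Ck_Suc_has_derivative]
  have "Ck k f" "Ck k g" using Suc.prems by (simp_all add: Ck_Suc_imp_Ck del: Ck.simps)
  then show ?case
    unfolding Ck_Suc_iff[OF has_derivative_mult[OF der]]
    using Suc by (auto intro!: Ck_add Suc.IH)
qed

lemma Ck_compose_fst:
  "Ck k g \<Longrightarrow> Ck k (\<lambda>z :: 'a::euclidean_space \<times> 'b::euclidean_space. g (fst z))"
proof (induction k arbitrary: g)
  case 0
  then show ?case
    by (auto intro!: continuous_on_compose2[of UNIV g] continuous_intros)
next
  case (Suc k)
  have der: "((\<lambda>z :: 'a \<times> 'b. g (fst z)) has_derivative
          (\<lambda>v. frechet_derivative g (at (fst z)) (fst v))) (at z)" for z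
    by (rule has_derivative_compose[OF has_derivative_fst[OF has_derivative_ident]
          Ck_Suc_has_derivative[OF Suc.prems]])
  have "Ck k (\<lambda>z :: 'a \<times> 'b. frechet_derivative g (at (fst z)) v)" for v
    using Suc.IH[of "\<lambda>x. frechet_derivative g (at x) v"] Suc.prems by simp
  then show ?case unfolding Ck_Suc_iff[OF der] by simp
qed

section \<open>Gradients and the regularity of the recursively defined functions\<close>

lemma gradient_inner:
  fixes g :: "'a::euclidean_space \<Rightarrow> real"
  assumes "(g has_derivative g') (at x)"
  shows "gradient g x \<bullet> v = g' v"
proof -
  interpret g': bounded_linear g' using assms by (rule has_derivative_bounded_linear)
  define D where "D = (\<Sum>e\<in>Basis. g' e *\<^sub>R e)"
  have D: "v \<bullet> D = g' v" for v
  proof -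
    have "g' v = g' (\<Sum>e\<in>Basis. (v \<bullet> e) *\<^sub>R e)" by (simp add: euclidean_representation)
    also have "\<dots> = v \<bullet> D"
      unfolding D_def g'.sum g'.scaleR inner_sum_right by (simp add: mult.commute)
    finally show ?thesis ..
  qed
  then have "GDERIV g x :> D" using assms by (simp add: gderiv_def)
  moreover have "D' = D" if "GDERIV g x :> D'" for D'
  proof -
    have "(\<lambda>v. v \<bullet> D') = g'"
      using has_derivative_unique[OF _ assms] that by (simp add: gderiv_def)
    then have "\<forall>v. v \<bullet> D' = v \<bullet> D" unfolding D by (simp add: fun_eq_iff)
    then show ?thesis by (simp only: vector_eq_ldot)
  qed
  ultimately have "gradient g x = D" unfolding gradient_def by (rule the_equality)
  then show ?thesis by (metis D inner_commute)
qed

lemma gradient_inner_fst: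
  fixes H :: "'a::euclidean_space \<times> 'b::euclidean_space \<Rightarrow> real"
  assumes "(H has_derivative H') (at (x, u))"
  shows "gradient (\<lambda>y. H (y, u)) x \<bullet> v = H' (v, 0)"
proof (rule gradient_inner[where g' = "\<lambda>v. H' (v, 0)"])
  have "((\<lambda>y. (y, u)) has_derivative (\<lambda>v. (v, 0))) (at x)"
    by (intro has_derivative_Pair has_derivative_ident has_derivative_const)
  from has_derivative_compose[OF this assms]
  show "((\<lambda>y. H (y, u)) has_derivative (\<lambda>v. H' (v, 0))) (at x)" .
qed

lemma gradient_inner_snd:
  fixes H :: "'a::euclidean_space \<times> 'b::euclidean_space \<Rightarrow> real"
  assumes "(H has_derivative H') (at (x, u))"
  shows "gradient (\<lambda>v. H (x, v)) u \<bullet> v = H' (0, v)"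
proof (rule gradient_inner[where g' = "\<lambda>v. H' (0, v)"])
  have "((\<lambda>v. (x, v)) has_derivative (\<lambda>v. (0, v))) (at u)"
    by (intro has_derivative_Pair has_derivative_ident has_derivative_const)
  from has_derivative_compose[OF this assms]
  show "((\<lambda>v. H (x, v)) has_derivative (\<lambda>v. H' (0, v))) (at u)" .
qed

text \<open>
  The derivative of \<open>h\<^sub>i\<close> along \<open>f\<close> is a linear combination of its directional derivatives in the
  directions \<open>(e, 0)\<close> with coefficients \<open>f \<bullet> e\<close>, which reduces the recursion to sums and products.
\<close>
lemma Ck_hseq:
  fixes f :: "real^'n \<Rightarrow> real^'m \<Rightarrow> real^'n"
  assumes f: "Ck (r + 1) (\<lambda>(x, u). f x u)" and h: "Ck (r + 2) h" and "i \<le> r + 1"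
  shows "Ck (r + 2 - i) (\<lambda>(x, u). hseq f h \<beta> i x u)"
  using \<open>i \<le> r + 1\<close>
proof (induction i)
  case 0
  then show ?case using Ck_compose_fst[OF h] by (simp add: case_prod_beta del: Ck.simps)
next
  case (Suc i)
  define H where "H = (\<lambda>(x, u). hseq f h \<beta> i x u)"
  define k where "k = r + 1 - i"
  have k: "r + 2 - i = Suc k" "r + 2 - Suc i = k" "k \<le> r + 1"
    using Suc.prems by (simp_all add: k_def)
  have H: "Ck (Suc k) H" using Suc k(1) by (simp add: H_def del: Ck.simps)
  let ?D = "\<lambda>z. frechet_derivative H (at z)"
  have hseq_Suc: "hseq f h \<beta> (Suc i) x u =
      (\<Sum>e\<in>Basis. (f x u \<bullet> e) * ?D (x, u) (e, 0)) + \<beta> * H (x, u)" for x u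
  proof -
    have der: "(H has_derivative ?D (x, u)) (at (x, u))" by (rule Ck_Suc_has_derivative[OF H])
    interpret D: bounded_linear "?D (x, u)" using der by (rule has_derivative_bounded_linear)
    have "(f x u, 0) = (\<Sum>e\<in>Basis. (f x u \<bullet> e) *\<^sub>R (e, 0 :: real^'m))"
      by (simp add: prod_eq_iff fst_sum snd_sum euclidean_representation)
    then have "?D (x, u) (f x u, 0) = (\<Sum>e\<in>Basis. (f x u \<bullet> e) * ?D (x, u) (e, 0))"
      by (simp only: D.sum D.scaleR real_scaleR_def)
    then show ?thesis
      using gradient_inner_fst[OF der, of "f x u"] by (simp add: H_def)
  qed
  have "Ck k (\<lambda>z. (\<Sum>e\<in>Basis. ((case z of (x, u) \<Rightarrow> f x u) \<bullet> e) * ?D z (e, 0)) + \<beta> * H z)"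
  proof (intro Ck_add Ck_sum Ck_mult Ck_const)
    show "Ck k H" by (rule Ck_Suc_imp_Ck[OF H])
    show "Ck k (\<lambda>z. ?D z (e, 0))" for e using H by simp
    show "Ck k (\<lambda>z. (case z of (x, u) \<Rightarrow> f x u) \<bullet> e)" for e
      by (rule Ck_bounded_linear[OF bounded_linear_inner_left Ck_mono[OF f k(3)]])
  qed simp
  moreover have "(\<lambda>(x, u). hseq f h \<beta> (Suc i) x u) =
      (\<lambda>z. (\<Sum>e\<in>Basis. ((case z of (x, u) \<Rightarrow> f x u) \<bullet> e) * ?D z (e, 0)) + \<beta> * H z)"
    using hseq_Suc by (auto simp del: hseq.simps)
  ultimately show ?case unfolding k(2) by simp
qed

section \<open>The minimizer of the quadratic program\<close>

text \<open>
  The cost is half the squared distance to a fixed point and the feasible set is an intersection of two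
  half-spaces, so the minimizer is the projection onto a closed convex set; only its existence and uniqueness
  make the definite description in the definition of the controller meaningful.
\<close>
lemma sgf_feasible_sgf:
  assumes "sgf_feasible f h b \<beta> r \<alpha> \<gamma> x u \<noteq> {}"
  shows "sgf f \<Phi> h b \<beta> r \<epsilon> \<alpha> \<gamma> x u \<in> sgf_feasible f h b \<beta> r \<alpha> \<gamma> x u"
proof -
  define C where "C = sgf_feasible f h b \<beta> r \<alpha> \<gamma> x u"
  define a where "a = - (\<epsilon> *\<^sub>R
       (transpose (matrix (frechet_derivative (steady_state f) (at u))) *v gradient \<Phi> x))"
  let ?J = "sgf_cost f \<Phi> \<epsilon> x u"
  have J: "?J q = (dist q a)\<^sup>2 / 2" for q
    by (simp add: sgf_cost_def a_def dist_norm)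
  have cost: "?J q \<le> ?J p \<longleftrightarrow> dist a q \<le> dist a p" for p q
    unfolding J by (simp add: dist_commute)
  have C: "C = {q. gradient b u \<bullet> q \<ge> - \<alpha> * b u} \<inter>
     {q. gradient (\<lambda>v. hseq f h \<beta> r x v) u \<bullet> q \<ge>
         - (gradient (\<lambda>y. hseq f h \<beta> r y u) x \<bullet> f x u) - \<gamma> * hseq f h \<beta> r x u}"
    unfolding C_def sgf_feasible_def by (auto simp: algebra_simps)
  have "closed C" "convex C"
    unfolding C
    by (intro closed_Int closed_halfspace_ge convex_Int convex_halfspace_ge)+
  define p where "p = closest_point C a"
  have p: "p \<in> C" "\<And>q. q \<in> C \<Longrightarrow> dist a p \<le> dist a q"
    using closest_point_exists[OF \<open>closed C\<close>] assms unfolding p_def C_def by auto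
  have "sgf f \<Phi> h b \<beta> r \<epsilon> \<alpha> \<gamma> x u = p"
    unfolding sgf_def C_def[symmetric]
  proof (rule the_equality)
    show "is_arg_min ?J (\<lambda>q. q \<in> C) p"
      using p cost by (auto simp: is_arg_min_linorder)
    show "q = p" if "is_arg_min ?J (\<lambda>q. q \<in> C) q" for q
      using any_closest_point_unique[OF \<open>convex C\<close> \<open>closed C\<close>, of q p a] p cost that
      by (auto simp: is_arg_min_linorder)
  qed
  then show ?thesis using p(1) by (simp add: C_def)
qed

section \<open>Differential inequalities and invariance\<close>

text \<open>The integrating factor \<open>exp (c * t)\<close> turns the differential inequality into monotonicity.\<close>
lemma nonneg_of_derivative_ge:
  fixes g :: "real \<Rightarrow> real"
  assumes der: "\<And>t. t \<in> time_interval T \<Longrightarrow>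
      (g has_vector_derivative g' t) (at t within time_interval T)"
    and ge: "\<And>t. t \<in> time_interval T \<Longrightarrow> g' t \<ge> - c * g t"
    and "g 0 \<ge> 0" and t: "t \<in> time_interval T"
  shows "g t \<ge> 0"
proof (cases "t = 0")
  case True
  then show ?thesis using \<open>g 0 \<ge> 0\<close> by simp
next
  case False
  have sub: "{0..t} \<subseteq> time_interval T"
    using t by (auto simp: time_interval_def intro: le_less_trans[of "ereal _" "ereal t"])
  let ?G = "\<lambda>s. exp (c * s) * g s"
  have "0 < t" using False t by (simp add: time_interval_def)
  have "(?G has_derivative (\<lambda>d. d * (exp (c * s) * (g' s + c * g s)))) (at s within {0..t})"
    if "s \<in> {0..t}" for s
  proof -
    have "(g has_vector_derivative g' s) (at s within {0..t})"
      using der sub that has_vector_derivative_within_subset by blast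
    then have "(g has_field_derivative g' s) (at s within {0..t})"
      by (simp add: has_real_derivative_iff_has_vector_derivative)
    then have "(?G has_field_derivative exp (c * s) * (g' s + c * g s)) (at s within {0..t})"
      by (auto intro!: derivative_eq_intros simp: algebra_simps)
    then show ?thesis by (simp add: has_field_derivative_def mult_commute_abs)
  qed
  from mvt_simple[OF \<open>0 < t\<close> this] obtain s where s: "s \<in> {0<..<t}"
    and "?G t - ?G 0 = (t - 0) * (exp (c * s) * (g' s + c * g s))"
    by auto
  moreover have "g' s + c * g s \<ge> 0"
    using ge[of s] s subsetD[OF sub, of s] by simp
  ultimately have "?G t - ?G 0 \<ge> 0" using \<open>0 < t\<close> by simp
  then have "0 \<le> exp (c * t) * g t" using \<open>g 0 \<ge> 0\<close> by simp
  then show ?thesis by (simp add: zero_le_mult_iff)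
qed

lemma ode_solution_comparison:
  fixes H :: "'a::real_normed_vector \<Rightarrow> real"
  assumes sol: "ode_solution D F T z"
    and der: "\<And>p. (H has_derivative H' p) (at p)"
    and ge: "\<And>t. t \<in> time_interval T \<Longrightarrow> H' (z t) (F (z t)) \<ge> - c * H (z t)"
    and init: "H (z 0) \<ge> 0" and t: "t \<in> time_interval T"
  shows "H (z t) \<ge> 0"
proof (rule nonneg_of_derivative_ge[OF _ ge _ t])
  fix s assume "s \<in> time_interval T"
  then have "(z has_vector_derivative F (z s)) (at s within time_interval T)"
    using sol by (simp add: ode_solution_def)
  from vector_derivative_diff_chain_within[OF this, of H "H' (z s)"] der
  have "(H \<circ> z has_vector_derivative H' (z s) (F (z s))) (at s within time_interval T)"
    by (simp add: has_derivative_at_withinI)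
  then show "((\<lambda>t. H (z t)) has_vector_derivative H' (z s) (F (z s))) (at s within time_interval T)"
    by (simp add: o_def)
qed (use init in simp_all)

theorem mainTheorem4:
  fixes f :: "real^'n \<Rightarrow> real^'m \<Rightarrow> real^'n"
    and \<Phi> h :: "real^'n \<Rightarrow> real"
    and b :: "real^'m \<Rightarrow> real"
    and \<beta> \<epsilon> \<alpha> \<gamma> :: real
    and r :: nat
  assumes steady: "\<forall>u. \<exists>!xe. ges_equilibrium (\<lambda>x. f x u) xe"
    and "\<beta> > 0"
    and "r \<ge> 1"
    and "Ck (r + 1) (\<lambda>(x, u). f x u)"
    and "Ck (r + 2) h"
    and "Sset f h b \<beta> r \<noteq> {}"
    and "\<forall>(x, u)\<in>Sset f h b \<beta> r.
           hseq f h \<beta> r x u = 0 \<longrightarrow> gradient (\<lambda>v. hseq f h \<beta> r x v) u \<noteq> 0"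
    and "\<forall>(x, u)\<in>Sset f h b \<beta> r. \<forall>i<r. gradient (\<lambda>v. hseq f h \<beta> i x v) u = 0"
    and "Ck 2 b"
    and "\<forall>(x, u)\<in>constraint_set h b. b u = 0 \<longrightarrow> gradient b u \<noteq> 0"
    and "Ck 2 \<Phi>"
    and "Ck 2 (steady_state f)"
    and "\<epsilon> > 0" and "\<alpha> > 0" and "\<gamma> > 0"
    and feasible: "\<forall>(x, u)\<in>(\<Inter>i\<in>{0..r}. Sset f h b \<beta> i). sgf_feasible f h b \<beta> r \<alpha> \<gamma> x u \<noteq> {}"
    and unique: "\<forall>z0\<in>(\<Inter>i\<in>{0..r}. Sset f h b \<beta> i).
           has_unique_solution (sgf_domain f h b \<beta> r \<alpha> \<gamma>)
             (sgf_closed_loop f \<Phi> h b \<beta> r \<epsilon> \<alpha> \<gamma>) z0"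
  shows "forward_invariant (sgf_domain f h b \<beta> r \<alpha> \<gamma>)
           (sgf_closed_loop f \<Phi> h b \<beta> r \<epsilon> \<alpha> \<gamma>) (\<Inter>i\<in>{0..r}. Sset f h b \<beta> i)"
proof -
  let ?D = "sgf_domain f h b \<beta> r \<alpha> \<gamma>"
  let ?F = "sgf_closed_loop f \<Phi> h b \<beta> r \<epsilon> \<alpha> \<gamma>"
  let ?q = "sgf f \<Phi> h b \<beta> r \<epsilon> \<alpha> \<gamma>"
  define H where "H i = (\<lambda>(x, u). hseq f h \<beta> i x u)" for i
  define H' where "H' i p = frechet_derivative (H i) (at p)" for i p
  define b' where "b' u = frechet_derivative b (at u)" for u
  have derH: "(H i has_derivative H' i p) (at p)" if "i \<le> r" for i p
  proof -
    have "Ck (r + 2 - i) (H i)"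
      unfolding H_def
      using \<open>Ck (r + 1) (\<lambda>(x, u). f x u)\<close> \<open>Ck (r + 2) h\<close> that by (intro Ck_hseq) simp_all
    then have "Ck (Suc 0) (H i)" using that by (elim Ck_mono) simp
    then show ?thesis unfolding H'_def by (rule Ck_Suc_has_derivative)
  qed
  have derb: "(b has_derivative b' u) (at u)" for u
    using \<open>Ck 2 b\<close> unfolding b'_def by (intro Ck_Suc_has_derivative[of 1]) (simp add: numeral_2_eq_2)
  have grad_x: "gradient (\<lambda>y. hseq f h \<beta> i y u) x \<bullet> v = H' i (x, u) (v, 0)" if "i \<le> r" for i x u v
    using gradient_inner_fst[OF derH[OF that]] by (simp add: H_def)
  have grad_u: "gradient (\<lambda>v. hseq f h \<beta> i x v) u \<bullet> v = H' i (x, u) (0, v)" if "i \<le> r" for i x u v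
    using gradient_inner_snd[OF derH[OF that]] by (simp add: H_def)
  have H'_split: "H' i p (v, q) = H' i p (v, 0) + H' i p (0, q)" if "i \<le> r" for i p v q
    using linear_add[OF has_derivative_linear[OF derH[OF that, of p]], of "(v, 0)" "(0, q)"] by simp
  show ?thesis
    unfolding forward_invariant_def
  proof (intro allI impI ballI, elim conjE)
    fix T z t
    assume sol: "ode_solution ?D ?F T z" and init: "z 0 \<in> (\<Inter>i\<in>{0..r}. Sset f h b \<beta> i)"
      and t: "t \<in> time_interval T"
    have init_b: "b (snd (z 0)) \<ge> 0"
      using init by (auto simp: Sset_def case_prod_beta)
    have init_H: "H i (z 0) \<ge> 0" if "i \<le> r" for i
      using init that by (auto simp: Sset_def H_def case_prod_beta)
    have F: "?F p = (f (fst p) (snd p), ?q (fst p) (snd p))" for p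
      by (simp add: sgf_closed_loop_def case_prod_beta)
    have feas: "?q (fst (z s)) (snd (z s)) \<in> sgf_feasible f h b \<beta> r \<alpha> \<gamma> (fst (z s)) (snd (z s))"
      if "s \<in> time_interval T" for s
    proof (rule sgf_feasible_sgf)
      have "z s \<in> ?D" using sol that by (simp add: ode_solution_def)
      then show "sgf_feasible f h b \<beta> r \<alpha> \<gamma> (fst (z s)) (snd (z s)) \<noteq> {}"
        by (simp add: sgf_domain_def case_prod_beta)
    qed
    have b: "b (snd (z s)) \<ge> 0" if s: "s \<in> time_interval T" for s
    proof (rule ode_solution_comparison[where H = "\<lambda>p. b (snd p)", OF sol _ _ init_b s])
      show "((\<lambda>p. b (snd p)) has_derivative (\<lambda>d. b' (snd p) (snd d))) (at p)"
        for p :: "(real^'n) \<times> (real^'m)"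
        by (rule has_derivative_compose[OF has_derivative_snd[OF has_derivative_ident] derb])
      show "b' (snd (z s)) (snd (?F (z s))) \<ge> - \<alpha> * b (snd (z s))" if "s \<in> time_interval T" for s
        using feas[OF that] by (simp add: F sgf_feasible_def gradient_inner[OF derb])
    qed
    have Hr: "H r (z s) \<ge> 0" if s: "s \<in> time_interval T" for s
    proof (rule ode_solution_comparison[where H = "H r", OF sol derH _ init_H s])
      show "H' r (z s) (?F (z s)) \<ge> - \<gamma> * H r (z s)" if "s \<in> time_interval T" for s
      proof -
        obtain x u where z: "z s = (x, u)" by (cases "z s")
        show ?thesis
          using feas[OF that] H'_split[of r "(x, u)" "f x u" "?q x u"]
          by (simp add: z F sgf_feasible_def grad_x grad_u H_def)
      qed
    qed simp_all
    have Hi: "\<forall>s\<in>time_interval T. H i (z s) \<ge> 0" if "i \<le> r" for i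
      using that
    proof (induction i rule: inc_induct)
      case base
      then show ?case using Hr by blast
    next
      case (step i)
      have "H' i (z s) (?F (z s)) \<ge> - \<beta> * H i (z s)" if s: "s \<in> time_interval T" for s
      proof -
        obtain x u where z: "z s = (x, u)" by (cases "z s")
        have "(x, u) \<in> Sset f h b \<beta> r"
          using b[OF s] Hr[OF s] by (simp add: z Sset_def H_def)
        then have "gradient (\<lambda>v. hseq f h \<beta> i x v) u = 0"
          using \<open>\<forall>(x, u)\<in>Sset f h b \<beta> r. \<forall>i<r. gradient (\<lambda>v. hseq f h \<beta> i x v) u = 0\<close> step by blast
        then have "H' i (x, u) (0, v) = 0" for v
          using grad_u[of i x u v] step by simp
        then have "H' i (z s) (?F (z s)) = H (Suc i) (z s) - \<beta> * H i (z s)"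
          using step grad_x[of i u x "f x u"] H'_split[of i "(x, u)" "f x u" "?q x u"]
          by (simp add: z F H_def)
        then show ?thesis using step.IH s by simp
      qed
      then show ?case
        using ode_solution_comparison[where H = "H i" and c = \<beta>, OF sol derH _ init_H] step
        by simp
    qed
    show "z t \<in> (\<Inter>i\<in>{0..r}. Sset f h b \<beta> i)"
      using b[OF t] Hi t by (auto simp: Sset_def H_def case_prod_beta)
  qed
qed

end
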